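(* A PCTL formula $\Phi$ is an absolute liveness property iff $\Phi\not\equiv\bot$ and $\Phi\equiv\mathbb{P}_{>0}(\Diamond\Phi)$.
   Context: Fix a finite non-empty set $\mathit{AP}$. A probabilistic tree (PT) is $T=(W,L,P)$ with $\epsilon\notin W$, $W\cup\{\epsilon\}\subseteq\mathbb{N}^*$ prefix-closed, $L:W\to\mathcal{P}(\mathit{AP})$, and $P$ a partial function from $W$ to distributions over $W$ with $P(\pi)(\pi')>0$ iff $\pi'=\pi\cdot n\in W$ for some $n$. $T$ is total if every node is a proper prefix of some node; $\mathbb{T}^\omega$ is the set of total PTs; a property is a subset of $\mathbb{T}^\omega$. Suffix: $T_2$ is a suffix of $T_1$ iff there is $\pi_1\in W_1$ with $\{\pi_1\cdot\pi_2\mid\pi_2\in W_2\}\subseteq W_1$, $L_2(\pi_2)=L_1(\pi_1\cdot\pi_2)$ for all $\pi_2\in W_2$, and $P_2(\pi_2,\pi'_2)=P_1(\pi_1\cdot\pi_2,\pi_1\cdot\pi'_2)$ for all $\pi_2,\pi'_2\in W_2$. $P$ is an absolute liveness property iff $P\ne\emptyset$ and for all $T,T'\in\mathbb{T}^\omega$: if $T'\in P$ and $T'$ is a suffix of $T$ then $T\in P$. A Markov chain (MC) is $\mathsf{D}=(S,\mathit{AP},\to,L,s_0)$ with $S\subseteq\mathbb{N}$ countable, $\to:S\to\mathit{Dist}(S)$ total, $L:S\to\mathcal{P}(\mathit{AP})$, initial state $s_0$. Its unfolding $T(\mathsf{D})$ has as nodes the least set of state sequences containing $s_0$ and closed under appending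 a state $t$ with $\mu(t)>0$ where $\mathrm{last}(\pi)\to\mu$; labels $L(\mathrm{last}(\pi))$; edge probabilities $P(\pi,\pi')=\mu(\mathrm{last}(\pi'))$ with $\mathrm{last}(\pi)\to\mu$. PCTL: state formulas $\Phi::=a\mid\Phi_1\land\Phi_2\mid\neg\Phi\mid\mathbb{P}_{\bowtie q}(\varphi)$, path formulas $\varphi::=\mathsf{X}\Phi\mid\Phi_1\mathsf{U}\Phi_2\mid\Phi_1\mathsf{W}\Phi_2$, $\bowtie\in\{<,>,\le,\ge\}$, $q\in[0,1]$, standard semantics on MCs; $\top=a\lor\neg a$, $\bot=\neg\top$, $\Diamond\Phi=\top\mathsf{U}\Phi$. $P_\Phi=\{T(\mathsf{D})\mid\mathsf{D}\models\Phi\}$ ($\mathsf{D}\models\Phi$ iff the initial state satisfies $\Phi$); $\Phi$ is an absolute liveness property iff $P_\Phi$ is; $\Phi\equiv\Psi$ iff $P_\Phi=P_\Psi$.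
   Formalization: The property of a formula is taken to be all total trees isomorphic to an unfolding T(D) with D satisfying it, and a probabilistic tree has at most one root; with literal unfoldings or with forests the claim already fails for the formula ⊤. *)

theory Defs
  imports "HOL-Probability.Probability" "HOL-Library.Sublist"
begin

text \<open>
  The finite non-empty set of atomic propositions is a type \<open>'ap\<close> of class \<open>finite\<close>
  (imposed in the theorem; no definition depends on it).
\<close>

section \<open>Probabilistic trees\<close>

record 'ap pt =
  nodes :: "nat list set"
  node_label :: "nat list \<rightharpoonup> 'ap set"
  node_dist :: "nat list \<rightharpoonup> nat list pmf"

text \<open>An undefined distribution contributes edge probability 0.\<close>

definition edge_prob :: "'ap pt \<Rightarrow> nat list \<Rightarrow> nat list \<Rightarrow> real" where
  "edge_prob T \<pi> \<pi>' = (case node_dist T \<pi> of None \<Rightarrow> 0 | Some \<mu> \<Rightarrow> pmf \<mu> \<pi>')"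

text \<open>
  Since the empty word is not a node, the nodes of length 1 are the roots; a tree, as opposed to a
  forest, has at most one of them.
\<close>

definition is_pt :: "'ap pt \<Rightarrow> bool" where
  "is_pt T \<longleftrightarrow>
     [] \<notin> nodes T \<and>
     (\<forall>\<pi> \<pi>'. \<pi>' \<in> nodes T \<union> {[]} \<and> prefix \<pi> \<pi>' \<longrightarrow> \<pi> \<in> nodes T \<union> {[]}) \<and>
     (\<forall>m n. [m] \<in> nodes T \<and> [n] \<in> nodes T \<longrightarrow> m = n) \<and>
     dom (node_label T) = nodes T \<and>
     dom (node_dist T) \<subseteq> nodes T \<and>
     (\<forall>\<pi>\<in>nodes T. \<forall>\<pi>'. edge_prob T \<pi> \<pi>' > 0 \<longleftrightarrow> (\<exists>n. \<pi>' = \<pi> @ [n] \<and> \<pi>' \<in> nodes T))"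

definition total_pts :: "'ap pt set" where
  "total_pts = {T. is_pt T \<and> (\<forall>\<pi>\<in>nodes T. \<exists>\<pi>'\<in>nodes T. strict_prefix \<pi> \<pi>')}"

definition suffix_pt :: "'ap pt \<Rightarrow> 'ap pt \<Rightarrow> bool" where
  "suffix_pt T2 T1 \<longleftrightarrow> (\<exists>\<pi>1\<in>nodes T1.
     {\<pi>1 @ \<pi>2 | \<pi>2. \<pi>2 \<in> nodes T2} \<subseteq> nodes T1 \<and>
     (\<forall>\<pi>2\<in>nodes T2. node_label T2 \<pi>2 = node_label T1 (\<pi>1 @ \<pi>2)) \<and>
     (\<forall>\<pi>2\<in>nodes T2. \<forall>\<pi>2'\<in>nodes T2.
        edge_prob T2 \<pi>2 \<pi>2' = edge_prob T1 (\<pi>1 @ \<pi>2) (\<pi>1 @ \<pi>2')))"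

definition absolute_liveness :: "'ap pt set \<Rightarrow> bool" where
  "absolute_liveness P \<longleftrightarrow> P \<noteq> {} \<and>
     (\<forall>T\<in>total_pts. \<forall>T'\<in>total_pts. T' \<in> P \<and> suffix_pt T' T \<longrightarrow> T \<in> P)"

text \<open>Isomorphism: renaming of the numbers used as branch directions.\<close>

definition pt_iso :: "'ap pt \<Rightarrow> 'ap pt \<Rightarrow> bool" where
  "pt_iso T1 T2 \<longleftrightarrow> (\<exists>f. bij_betw f (nodes T1) (nodes T2) \<and>
     (\<forall>\<pi>\<in>nodes T1. \<forall>\<pi>'\<in>nodes T1. prefix \<pi> \<pi>' \<longleftrightarrow> prefix (f \<pi>) (f \<pi>')) \<and>
     (\<forall>\<pi>\<in>nodes T1. node_label T2 (f \<pi>) = node_label T1 \<pi>) \<and>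
     (\<forall>\<pi>\<in>nodes T1. \<forall>\<pi>'\<in>nodes T1. edge_prob T2 (f \<pi>) (f \<pi>') = edge_prob T1 \<pi> \<pi>'))"


section \<open>Markov chains\<close>

record 'ap mc =
  states :: "nat set"
  trans_dist :: "nat \<Rightarrow> nat pmf"
  state_label :: "nat \<Rightarrow> 'ap set"
  init :: nat

text \<open>Values of \<open>trans_dist\<close> and \<open>state_label\<close> outside \<open>states\<close> are irrelevant.\<close>

definition is_mc :: "'ap mc \<Rightarrow> bool" where
  "is_mc D \<longleftrightarrow> init D \<in> states D \<and> (\<forall>s\<in>states D. set_pmf (trans_dist D s) \<subseteq> states D)"

inductive_set unfolding_nodes :: "'ap mc \<Rightarrow> nat list set" for D :: "'ap mc" where
  root: "[init D] \<in> unfolding_nodes D"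
| step: "\<pi> \<in> unfolding_nodes D \<Longrightarrow> pmf (trans_dist D (last \<pi>)) t > 0 \<Longrightarrow> \<pi> @ [t] \<in> unfolding_nodes D"

definition unfolding_pt :: "'ap mc \<Rightarrow> 'ap pt" where
  "unfolding_pt D = \<lparr>
     nodes = unfolding_nodes D,
     node_label = (\<lambda>\<pi>. if \<pi> \<in> unfolding_nodes D then Some (state_label D (last \<pi>)) else None),
     node_dist = (\<lambda>\<pi>. if \<pi> \<in> unfolding_nodes D
                       then Some (map_pmf (\<lambda>t. \<pi> @ [t]) (trans_dist D (last \<pi>))) else None)\<rparr>"

lemma edge_prob_unfolding_child:
  assumes "\<pi> \<in> unfolding_nodes D"
  shows "edge_prob (unfolding_pt D) \<pi> (\<pi> @ [t]) = pmf (trans_dist D (last \<pi>)) t"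
  using assms pmf_map_inj'[of "\<lambda>t. \<pi> @ [t]" "trans_dist D (last \<pi>)" t]
  by (simp add: edge_prob_def unfolding_pt_def inj_def)

lemma edge_prob_unfolding_pos:
  assumes "\<pi> \<in> unfolding_nodes D"
  shows "edge_prob (unfolding_pt D) \<pi> \<pi>' > 0 \<longleftrightarrow> (\<exists>t. \<pi>' = \<pi> @ [t] \<and> \<pi>' \<in> unfolding_nodes D)"
proof
  assume "edge_prob (unfolding_pt D) \<pi> \<pi>' > 0"
  then have "\<pi>' \<in> set_pmf (map_pmf (\<lambda>t. \<pi> @ [t]) (trans_dist D (last \<pi>)))"
    using assms by (simp add: edge_prob_def unfolding_pt_def pmf_positive_iff del: set_map_pmf)
  then show "\<exists>t. \<pi>' = \<pi> @ [t] \<and> \<pi>' \<in> unfolding_nodes D"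
    using assms by (auto intro!: unfolding_nodes.step simp: pmf_positive)
next
  assume "\<exists>t. \<pi>' = \<pi> @ [t] \<and> \<pi>' \<in> unfolding_nodes D"
  then obtain t where t: "\<pi>' = \<pi> @ [t]" "\<pi> @ [t] \<in> unfolding_nodes D" by blast
  have "\<pi> \<noteq> []" using assms by (auto elim: unfolding_nodes.cases)
  with t(2) have "pmf (trans_dist D (last \<pi>)) t > 0"
    by (cases rule: unfolding_nodes.cases) auto
  then show "edge_prob (unfolding_pt D) \<pi> \<pi>' > 0"
    using assms t by (simp add: edge_prob_unfolding_child)
qed

lemma unfolding_nodes_prefix:
  "\<pi>' \<in> unfolding_nodes D \<Longrightarrow> prefix \<pi> \<pi>' \<Longrightarrow> \<pi> = [] \<or> \<pi> \<in> unfolding_nodes D"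
proof (induction rule: unfolding_nodes.induct)
  case root
  then show ?case by (auto simp: prefix_Cons intro: unfolding_nodes.root)
next
  case (step \<pi>' t)
  then show ?case by (auto intro: unfolding_nodes.step)
qed

lemma hd_unfolding_nodes: "\<pi> \<in> unfolding_nodes D \<Longrightarrow> \<pi> \<noteq> [] \<and> hd \<pi> = init D"
  by (induction rule: unfolding_nodes.induct) auto

lemma unfolding_total_pt: "unfolding_pt D \<in> total_pts"
proof -
  have n: "nodes (unfolding_pt D) = unfolding_nodes D" by (simp add: unfolding_pt_def)
  have "is_pt (unfolding_pt D)"
    unfolding is_pt_def n
  proof (intro conjI allI impI ballI)
    show "[] \<notin> unfolding_nodes D" by (auto dest: hd_unfolding_nodes)
    show "\<pi> \<in> unfolding_nodes D \<union> {[]}"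
      if "\<pi>' \<in> unfolding_nodes D \<union> {[]} \<and> prefix \<pi> \<pi>'" for \<pi> \<pi>'
      using that unfolding_nodes_prefix by auto
    show "a = b" if "[a] \<in> unfolding_nodes D \<and> [b] \<in> unfolding_nodes D" for a b
      using that by (auto dest!: hd_unfolding_nodes)
    show "dom (node_label (unfolding_pt D)) = unfolding_nodes D"
      "dom (node_dist (unfolding_pt D)) \<subseteq> unfolding_nodes D"
      by (auto simp: unfolding_pt_def dom_def)
  qed (rule edge_prob_unfolding_pos)
  moreover have "\<exists>\<pi>'\<in>unfolding_nodes D. strict_prefix \<pi> \<pi>'" if "\<pi> \<in> unfolding_nodes D" for \<pi>
  proof -
    obtain t where "t \<in> set_pmf (trans_dist D (last \<pi>))" using set_pmf_not_empty by fastforce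
    then have "\<pi> @ [t] \<in> unfolding_nodes D"
      using that by (auto intro: unfolding_nodes.step simp: pmf_positive)
    then show ?thesis by (intro bexI[of _ "\<pi> @ [t]"]) (auto simp: strict_prefix_def)
  qed
  ultimately show ?thesis by (simp add: total_pts_def n)
qed


section \<open>The probability measure on paths\<close>

text \<open>
  At every step a successor is drawn independently for all states at once; the walk uses the one
  drawn for its current state. The resulting law on paths is characterised by the measure of the
  cylinder sets (lemmas \<open>emeasure_path_measure_cylinder\<close> and \<open>path_measure_unique\<close>).
\<close>

primcorec walk :: "nat \<Rightarrow> (nat \<Rightarrow> nat) stream \<Rightarrow> nat stream" where
  "walk s \<omega> = s ## walk (shd \<omega> s) (stl \<omega>)"

definition path_measure :: "(nat \<Rightarrow> nat pmf) \<Rightarrow> nat \<Rightarrow> nat stream measure" where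
  "path_measure K s =
     distr (stream_space (\<Pi>\<^sub>M t\<in>UNIV. measure_pmf (K t))) (stream_space (count_space UNIV)) (walk s)"

lemma space_path_measure [simp]: "space (path_measure K s) = UNIV"
  by (simp add: path_measure_def space_stream_space)

lemma sets_path_measure [simp, measurable_cong]:
  "sets (path_measure K s) = sets (stream_space (count_space UNIV))"
  by (simp add: path_measure_def)

lemma measurable_walk [measurable]:
  "walk s \<in> stream_space (\<Pi>\<^sub>M t\<in>UNIV. measure_pmf (K t)) \<rightarrow>\<^sub>M stream_space (count_space UNIV)"
proof -
  let ?M = "stream_space (\<Pi>\<^sub>M t\<in>UNIV. measure_pmf (K t))"
  have "(\<lambda>\<omega>. walk (g \<omega>) (h \<omega>)) \<in> N \<rightarrow>\<^sub>M stream_space (count_space UNIV)"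
    if "g \<in> N \<rightarrow>\<^sub>M count_space UNIV" "h \<in> N \<rightarrow>\<^sub>M ?M" for g :: "_ \<Rightarrow> nat" and h and N :: "'x measure"
  proof (rule measurable_stream_space2)
    show "(\<lambda>\<omega>. walk (g \<omega>) (h \<omega>) !! n) \<in> N \<rightarrow>\<^sub>M count_space UNIV" for n
      using that
    proof (induction n arbitrary: g h)
      case 0 then show ?case by simp
    next
      case (Suc n)
      note [measurable] = Suc.prems
      have c: "(\<lambda>\<omega>. shd (h \<omega>) t) \<in> N \<rightarrow>\<^sub>M count_space UNIV" for t
      proof -
        have "(\<lambda>\<omega>. shd (h \<omega>)) \<in> N \<rightarrow>\<^sub>M (\<Pi>\<^sub>M t\<in>UNIV. measure_pmf (K t))" by measurable
        then have "(\<lambda>\<omega>. shd (h \<omega>) t) \<in> N \<rightarrow>\<^sub>M measure_pmf (K t)"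
          by (rule measurable_compose[OF _ measurable_component_singleton]) simp
        then show ?thesis by simp
      qed
      have 1: "(\<lambda>\<omega>. shd (h \<omega>) (g \<omega>)) \<in> N \<rightarrow>\<^sub>M count_space UNIV"
        using measurable_compose_countable[where f="\<lambda>t \<omega>. shd (h \<omega>) t", OF c Suc.prems(1)] .
      have 2: "(\<lambda>\<omega>. stl (h \<omega>)) \<in> N \<rightarrow>\<^sub>M ?M" by measurable
      from Suc.IH[OF 1 2] show ?case by simp
    qed
  qed
  from this[of "\<lambda>_. s" _ "\<lambda>\<omega>. \<omega>"] show ?thesis by simp
qed

lemma prob_space_path_measure: "prob_space (path_measure K s)"
  unfolding path_measure_def
  by (intro prob_space.prob_space_distr prob_space.prob_space_stream_space prob_space_PiM
      prob_space_measure_pmf measurable_walk)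

lemma emeasure_path_measure_step:
  assumes X: "X \<in> sets (stream_space (count_space UNIV))"
  shows "emeasure (path_measure K s) X =
    (\<integral>\<^sup>+t. emeasure (path_measure K t) {\<omega>. s ## \<omega> \<in> X} \<partial>measure_pmf (K s))"
proof -
  let ?P = "\<Pi>\<^sub>M t\<in>UNIV. measure_pmf (K t)"
  interpret P: prob_space ?P by (intro prob_space_PiM prob_space_measure_pmf)
  interpret PP: product_prob_space "\<lambda>t. measure_pmf (K t)" UNIV by standard
  have sp: "space (stream_space ?P) = UNIV"
    by (simp add: space_stream_space space_PiM)
  have S: "walk s -` X \<in> sets (stream_space ?P)"
    using measurable_sets[OF measurable_walk X, of s K] by (simp add: sp)
  have X': "{\<omega>. s ## \<omega> \<in> X} \<in> sets (stream_space (count_space UNIV))"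
  proof -
    have "(\<lambda>\<omega>. s ## \<omega>) \<in> stream_space (count_space UNIV) \<rightarrow>\<^sub>M stream_space (count_space UNIV)"
      by measurable
    from measurable_sets[OF this X] show ?thesis by (simp add: space_stream_space vimage_def)
  qed
  have *: "emeasure (stream_space ?P) {\<omega>. t ## \<omega> \<in> walk s -` X} =
      emeasure (path_measure K (t s)) {\<omega>. s ## \<omega> \<in> X}" for t
    unfolding path_measure_def
    by (subst emeasure_distr[OF measurable_walk X'])
       (auto simp: sp walk.code[of s "_ ## _"] intro!: arg_cong2[where f=emeasure])
  have "emeasure (path_measure K s) X = emeasure (stream_space ?P) (walk s -` X)"
    by (simp add: path_measure_def emeasure_distr[OF measurable_walk X] sp)
  also have "\<dots> = (\<integral>\<^sup>+t. emeasure (path_measure K (t s)) {\<omega>. s ## \<omega> \<in> X} \<partial>?P)"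
    by (subst P.emeasure_stream_space[OF S]) (simp add: sp *[simplified vimage_eq mem_Collect_eq])
  also have "\<dots> = (\<integral>\<^sup>+t. emeasure (path_measure K t) {\<omega>. s ## \<omega> \<in> X} \<partial>distr ?P (measure_pmf (K s)) (\<lambda>t. t s))"
    by (subst nn_integral_distr) auto
  also have "distr ?P (measure_pmf (K s)) (\<lambda>t. t s) = measure_pmf (K s)"
    using PP.PiM_component[of s] by simp
  finally show ?thesis .
qed

lemma emeasure_path_measure_cylinder:
  "emeasure (path_measure K s) {\<omega>. stake (Suc (length \<pi>)) \<omega> = s # \<pi>} =
     ennreal (\<Prod>i<length \<pi>. pmf (K ((s # \<pi>) ! i)) (\<pi> ! i))"
proof (induction \<pi> arbitrary: s)
  have m: "{\<omega>. stake n \<omega> = \<pi>} \<in> sets (stream_space (count_space UNIV))" for n and \<pi> :: "nat list"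
    using measurable_sets[OF measurable_stake, of "{\<pi>}" n] by (simp add: space_stream_space vimage_def)
  {
    case Nil
    interpret prob_space "path_measure K t" for t by (rule prob_space_path_measure)
    from emeasure_space_1 show ?case
      by (subst emeasure_path_measure_step[OF m]) (simp add: measure_pmf.emeasure_space_1)
  next
    case (Cons t \<pi>)
    have 0: "emeasure (path_measure K u) {\<omega>. stake (Suc (length \<pi>)) \<omega> = t # \<pi>} = 0" if "u \<noteq> t" for u
      by (subst emeasure_path_measure_step) (use that in \<open>simp_all add: m del: stake.simps(2), simp\<close>)
    let ?c = "emeasure (path_measure K t) {\<omega>. stake (Suc (length \<pi>)) \<omega> = t # \<pi>}"
    have "emeasure (path_measure K s) {\<omega>. stake (Suc (length (t # \<pi>))) \<omega> = s # t # \<pi>} =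
      (\<integral>\<^sup>+u. emeasure (path_measure K u) {\<omega>. stake (Suc (length \<pi>)) \<omega> = t # \<pi>} \<partial>measure_pmf (K s))"
      by (subst emeasure_path_measure_step[OF m]) simp
    also have "\<dots> = (\<integral>\<^sup>+u. ?c * indicator {t} u \<partial>measure_pmf (K s))"
      by (intro nn_integral_cong) (auto simp: 0 split: split_indicator simp del: stake.simps)
    also have "\<dots> = ?c * emeasure (measure_pmf (K s)) {t}"
      by (simp add: nn_integral_cmult_indicator del: stake.simps)
    also have "\<dots> = ennreal (pmf (K s) t * (\<Prod>i<length \<pi>. pmf (K ((t # \<pi>) ! i)) (\<pi> ! i)))"
      by (simp add: Cons.IH emeasure_pmf_single ennreal_mult prod_nonneg mult.commute del: stake.simps)
    also have "pmf (K s) t * (\<Prod>i<length \<pi>. pmf (K ((t # \<pi>) ! i)) (\<pi> ! i)) =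
      (\<Prod>i<length (t # \<pi>). pmf (K ((s # t # \<pi>) ! i)) ((t # \<pi>) ! i))"
      by (simp only: length_Cons prod.lessThan_Suc_shift) simp
    finally show ?case .
  }
qed

lemma path_measure_unique:
  assumes "prob_space M" and sets: "sets M = sets (stream_space (count_space UNIV))"
    and cyl: "\<And>\<pi>. emeasure M {\<omega>. stake (Suc (length \<pi>)) \<omega> = s # \<pi>} =
      ennreal (\<Prod>i<length \<pi>. pmf (K ((s # \<pi>) ! i)) (\<pi> ! i))"
  shows "M = path_measure K s"
proof (rule stream_space_eq_sstart[where S=UNIV])
  interpret M: prob_space M by fact
  have m: "{\<omega>. stake n \<omega> = \<pi>} \<in> sets (stream_space (count_space UNIV))" for n and \<pi> :: "nat list"
    using measurable_sets[OF measurable_stake, of "{\<pi>}" n] by (simp add: space_stream_space vimage_def)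
  have st: "sstart UNIV xs = {\<omega>. stake (length xs) \<omega> = xs}" for xs :: "nat list"
  proof -
    have "\<omega> \<in> sstart UNIV xs \<longleftrightarrow> stake (length xs) \<omega> = xs" for \<omega>
      by (induction xs arbitrary: \<omega>) (simp_all del: sstart.simps(2))
    then show ?thesis by blast
  qed
  show "emeasure M (sstart UNIV xs) = emeasure (path_measure K s) (sstart UNIV xs)"
    if ne: "xs \<noteq> []" for xs
  proof -
    obtain t \<pi> where xs: "xs = t # \<pi>" using ne by (cases xs) auto
    show ?thesis
    proof (cases "t = s")
      case True
      then show ?thesis
        using cyl[of \<pi>] emeasure_path_measure_cylinder[of K s \<pi>] by (simp add: st xs del: stake.simps)
    next
      case False
      have z: "emeasure N {\<omega>. stake (length xs) \<omega> = xs} = 0"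
        if N: "prob_space N" "sets N = sets (stream_space (count_space UNIV))"
          and o: "emeasure N {\<omega>. stake (Suc 0) \<omega> = [s]} = 1" for N
      proof -
        interpret N: prob_space N by fact
        have "AE \<omega> in N. \<omega> \<in> {\<omega>. stake (Suc 0) \<omega> = [s]}"
          using o by (intro N.AE_prob_1) (simp add: N.emeasure_eq_measure)
        then have "AE \<omega> in N. \<not> stake (length xs) \<omega> = xs"
          by eventually_elim (use False xs in auto)
        then show ?thesis
          using m[of "length xs" xs] N(2) sets_eq_imp_space_eq[OF N(2)]
          by (subst (asm) AE_iff_measurable[OF _ refl]) (simp_all add: space_stream_space)
      qed
      have "emeasure M {\<omega>. stake (length xs) \<omega> = xs} = 0"
        by (rule z) (use cyl[of "[]"] sets in \<open>simp_all add: M.prob_space_axioms\<close>)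
      moreover have "emeasure (path_measure K s) {\<omega>. stake (length xs) \<omega> = xs} = 0"
        by (rule z) (use emeasure_path_measure_cylinder[of K s "[]"] in \<open>simp_all add: prob_space_path_measure\<close>)
      ultimately show ?thesis by (simp add: st)
    qed
  qed
qed (auto simp: sets assms prob_space_path_measure)


section \<open>PCTL\<close>

datatype cmp = Less | Greater | LessEq | GreaterEq

primrec cmp_rel :: "cmp \<Rightarrow> real \<Rightarrow> real \<Rightarrow> bool" where
  "cmp_rel Less x q \<longleftrightarrow> x < q"
| "cmp_rel Greater x q \<longleftrightarrow> x > q"
| "cmp_rel LessEq x q \<longleftrightarrow> x \<le> q"
| "cmp_rel GreaterEq x q \<longleftrightarrow> x \<ge> q"

datatype 'ap state_formula =
    Atom 'ap
  | Conj "'ap state_formula" "'ap state_formula"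
  | Neg "'ap state_formula"
  | Prob cmp real "'ap path_formula"
and 'ap path_formula =
    Next "'ap state_formula"
  | Until "'ap state_formula" "'ap state_formula"
  | WeakUntil "'ap state_formula" "'ap state_formula"

primrec wf_state :: "'ap state_formula \<Rightarrow> bool"
  and wf_path :: "'ap path_formula \<Rightarrow> bool" where
  "wf_state (Atom a) \<longleftrightarrow> True"
| "wf_state (Conj \<Phi> \<Psi>) \<longleftrightarrow> wf_state \<Phi> \<and> wf_state \<Psi>"
| "wf_state (Neg \<Phi>) \<longleftrightarrow> wf_state \<Phi>"
| "wf_state (Prob c q \<phi>) \<longleftrightarrow> q \<in> {0..1} \<and> wf_path \<phi>"
| "wf_path (Next \<Phi>) \<longleftrightarrow> wf_state \<Phi>"
| "wf_path (Until \<Phi> \<Psi>) \<longleftrightarrow> wf_state \<Phi> \<and> wf_state \<Psi>"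
| "wf_path (WeakUntil \<Phi> \<Psi>) \<longleftrightarrow> wf_state \<Phi> \<and> wf_state \<Psi>"

primrec sat :: "'ap state_formula \<Rightarrow> 'ap mc \<Rightarrow> nat \<Rightarrow> bool"
  and path_sat :: "'ap path_formula \<Rightarrow> 'ap mc \<Rightarrow> nat stream \<Rightarrow> bool" where
  "sat (Atom a) D s \<longleftrightarrow> a \<in> state_label D s"
| "sat (Conj \<Phi> \<Psi>) D s \<longleftrightarrow> sat \<Phi> D s \<and> sat \<Psi> D s"
| "sat (Neg \<Phi>) D s \<longleftrightarrow> \<not> sat \<Phi> D s"
| "sat (Prob c q \<phi>) D s \<longleftrightarrow>
     cmp_rel c (measure (path_measure (trans_dist D) s) {\<omega>. path_sat \<phi> D \<omega>}) q"
| "path_sat (Next \<Phi>) D \<omega> \<longleftrightarrow> sat \<Phi> D (\<omega> !! 1)"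
| "path_sat (Until \<Phi> \<Psi>) D \<omega> \<longleftrightarrow> (\<exists>j. sat \<Psi> D (\<omega> !! j) \<and> (\<forall>k<j. sat \<Phi> D (\<omega> !! k)))"
| "path_sat (WeakUntil \<Phi> \<Psi>) D \<omega> \<longleftrightarrow>
     (\<exists>j. sat \<Psi> D (\<omega> !! j) \<and> (\<forall>k<j. sat \<Phi> D (\<omega> !! k))) \<or> (\<forall>k. sat \<Phi> D (\<omega> !! k))"

text \<open>The events measured in the semantics of \<open>Prob\<close> are measurable.\<close>

lemma path_sat_measurable: "{\<omega>. path_sat \<phi> D \<omega>} \<in> sets (path_measure K s)"
proof -
  have "Measurable.pred (stream_space (count_space UNIV)) (path_sat \<phi> D)"
    by (cases \<phi>) (simp_all add: path_sat.simps[abs_def])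
  then show ?thesis by (simp add: pred_def space_stream_space)
qed

definition mc_sat :: "'ap mc \<Rightarrow> 'ap state_formula \<Rightarrow> bool" where
  "mc_sat D \<Phi> \<longleftrightarrow> sat \<Phi> D (init D)"

definition Disj :: "'ap state_formula \<Rightarrow> 'ap state_formula \<Rightarrow> 'ap state_formula" where
  "Disj \<Phi> \<Psi> = Neg (Conj (Neg \<Phi>) (Neg \<Psi>))"

definition Top :: "'ap state_formula" where
  "Top = (let a = (SOME a. True) in Disj (Atom a) (Neg (Atom a)))"

definition Bot :: "'ap state_formula" where
  "Bot = Neg Top"

definition Eventually :: "'ap state_formula \<Rightarrow> 'ap path_formula" where
  "Eventually \<Phi> = Until Top \<Phi>"

text \<open>
  Probabilistic trees are identified up to isomorphism, so the property of a formula consists of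
  all total trees isomorphic to the unfolding of a model. (Literal unfoldings would not do: there,
  nodes ending in the same number carry the same label, so already the property of \<open>Top\<close> would
  not be closed under adding a new root.)
\<close>

definition property_of :: "'ap state_formula \<Rightarrow> 'ap pt set" where
  "property_of \<Phi> = {T \<in> total_pts. \<exists>D. is_mc D \<and> mc_sat D \<Phi> \<and> pt_iso (unfolding_pt D) T}"

definition pctl_absolute_liveness :: "'ap state_formula \<Rightarrow> bool" where
  "pctl_absolute_liveness \<Phi> \<longleftrightarrow> absolute_liveness (property_of \<Phi>)"

definition pctl_equiv :: "'ap state_formula \<Rightarrow> 'ap state_formula \<Rightarrow> bool" where
  "pctl_equiv \<Phi> \<Psi> \<longleftrightarrow> property_of \<Phi> = property_of \<Psi>"

end

theory Submission
  imports Defs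
begin

text \<open>
  A total tree \<open>T\<close> is itself a Markov chain, with its nodes as states, and \<open>T\<close> is isomorphic to the
  unfolding of that chain. PCTL satisfaction is invariant under functional lumpings of Markov
  chains, in particular under the map sending a node of an unfolding to its last state, under tree
  isomorphisms, and under the inclusion of a suffix. Hence membership of \<open>T\<close> in the property of a
  formula can be decided on the chain of \<open>T\<close> alone, \<open>T\<close> satisfies \<open>\<P>\<^sub>>\<^sub>0(\<diamond>\<Phi>)\<close> iff some node of \<open>T\<close>
  satisfies \<open>\<Phi>\<close>, and the non-root nodes satisfying \<open>\<Phi>\<close> are the roots of the suffixes of \<open>T\<close> in the
  property of \<open>\<Phi>\<close>. So \<open>\<P>\<^sub>>\<^sub>0(\<diamond>\<Phi>)\<close> denotes the closure of the property of \<open>\<Phi>\<close> under passing from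
  a suffix to the whole tree, and absolute liveness says that this closure adds nothing.
\<close>

section \<open>Visited states and lumping of Markov chains\<close>

abbreviation succ_rel :: "(nat \<Rightarrow> nat pmf) \<Rightarrow> nat \<Rightarrow> nat \<Rightarrow> bool" where
  "succ_rel K s t \<equiv> t \<in> set_pmf (K s)"

lemma emeasure_path_measure_UNIV [simp]: "emeasure (path_measure K s) UNIV = 1"
  using prob_space.emeasure_space_1[OF prob_space_path_measure] by simp

lemma sets_snth: "{\<omega>. \<omega> !! n \<in> A} \<in> sets (stream_space (count_space UNIV))"
  using measurable_sets[OF measurable_snth, of A "count_space UNIV" n]
  by (simp add: space_stream_space vimage_def)

lemma emeasure_path_measure_snth_eq_0_iff:
  "emeasure (path_measure K s) {\<omega>. \<omega> !! n \<in> A} = 0 \<longleftrightarrow> (\<forall>t\<in>A. \<not> (succ_rel K ^^ n) s t)"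
proof (induction n arbitrary: s)
  case 0
  show ?case
    by (subst emeasure_path_measure_step[OF sets_snth]) (auto simp: measure_pmf.emeasure_space_1)
next
  case (Suc n)
  have "emeasure (path_measure K s) {\<omega>. \<omega> !! Suc n \<in> A} = 0 \<longleftrightarrow>
      (\<integral>\<^sup>+t. emeasure (path_measure K t) {\<omega>. \<omega> !! n \<in> A} \<partial>measure_pmf (K s)) = 0"
    by (subst emeasure_path_measure_step[OF sets_snth]) simp
  also have "\<dots> \<longleftrightarrow> (\<forall>u\<in>set_pmf (K s). \<forall>t\<in>A. \<not> (succ_rel K ^^ n) u t)"
    by (simp add: nn_integral_0_iff_AE AE_measure_pmf_iff Suc.IH)
  finally show ?case
    by (auto simp: relpowp_Suc_left simp del: relpowp.simps)
qed

lemma emeasure_path_measure_visit_eq_0_iff: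
  "emeasure (path_measure K s) {\<omega>. \<exists>n. \<omega> !! n \<in> A} = 0 \<longleftrightarrow> (\<forall>t\<in>A. \<not> (succ_rel K)\<^sup>*\<^sup>* s t)"
proof -
  have "emeasure (path_measure K s) (\<Union>n. {\<omega>. \<omega> !! n \<in> A}) = 0 \<longleftrightarrow>
      (\<forall>n. emeasure (path_measure K s) {\<omega>. \<omega> !! n \<in> A} = 0)"
  proof
    assume null: "emeasure (path_measure K s) (\<Union>n. {\<omega>. \<omega> !! n \<in> A}) = 0"
    show "\<forall>n. emeasure (path_measure K s) {\<omega>. \<omega> !! n \<in> A} = 0"
      by (intro allI emeasure_eq_0[OF _ null]) (auto simp: sets_snth)
  qed (intro emeasure_UN_eq_0, auto simp: sets_snth)
  moreover have "(\<Union>n. {\<omega>. \<omega> !! n \<in> A}) = {\<omega>. \<exists>n. \<omega> !! n \<in> A}" by blast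
  ultimately show ?thesis
    by (simp add: emeasure_path_measure_snth_eq_0_iff rtranclp_power) blast
qed

lemma AE_path_measure_closed:
  assumes closed: "\<And>s. s \<in> S \<Longrightarrow> set_pmf (K s) \<subseteq> S" and "s \<in> S"
  shows "AE \<omega> in path_measure K s. \<forall>n. \<omega> !! n \<in> S"
proof -
  have reach: "t \<in> S" if "(succ_rel K)\<^sup>*\<^sup>* s t" for t
    using that \<open>s \<in> S\<close> closed by (induction rule: rtranclp_induct) auto
  have "AE \<omega> in path_measure K s. \<omega> !! n \<in> S" for n
  proof (rule AE_I)
    show "emeasure (path_measure K s) {\<omega>. \<omega> !! n \<in> - S} = 0"
      unfolding emeasure_path_measure_snth_eq_0_iff using reach relpowp_imp_rtranclp by fast
  qed (use sets_snth[of n "- S"] in auto)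
  then show ?thesis by (simp add: AE_all_countable)
qed

lemma measurable_smap_path_measure:
  "smap h \<in> path_measure K s \<rightarrow>\<^sub>M stream_space (count_space UNIV)"
  by (rule measurable_stream_space2) (simp add: measurable_compose[OF measurable_snth])

lemma emeasure_path_measure_lumping_sstart:
  assumes closed: "\<And>s. s \<in> S \<Longrightarrow> set_pmf (K s) \<subseteq> S"
    and lump: "\<And>s. s \<in> S \<Longrightarrow> K' (h s) = map_pmf h (K s)"
    and "s \<in> S"
  shows "emeasure (path_measure K' (h s)) (sstart UNIV xs) =
    emeasure (path_measure K s) (smap h -` sstart UNIV xs)"
  using \<open>s \<in> S\<close>
proof (induction xs arbitrary: s)
  case Nil
  show ?case by simp
next
  case (Cons x xs)
  have vimage_sets: "smap h -` sstart UNIV (x # xs) \<in> sets (stream_space (count_space UNIV))"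
    using measurable_sets[OF measurable_smap_path_measure sets_sstart] by simp
  have "emeasure (path_measure K' (h s)) (sstart UNIV (x # xs)) =
      (\<integral>\<^sup>+t. emeasure (path_measure K' (h t)) {\<omega>. h s = x \<and> \<omega> \<in> sstart UNIV xs} \<partial>measure_pmf (K s))"
    by (subst emeasure_path_measure_step[OF sets_sstart]) (simp add: lump[OF Cons.prems])
  also have "\<dots> = (\<integral>\<^sup>+t. emeasure (path_measure K t) {\<omega>. h s = x \<and> smap h \<omega> \<in> sstart UNIV xs} \<partial>measure_pmf (K s))"
    using Cons.IH closed[OF Cons.prems]
    by (intro nn_integral_cong_AE) (cases "h s = x", auto simp: AE_measure_pmf_iff vimage_def)
  also have "\<dots> = emeasure (path_measure K s) (smap h -` sstart UNIV (x # xs))"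
    by (subst emeasure_path_measure_step[OF vimage_sets, where s=s]) simp
  finally show ?case .
qed

lemma path_measure_lumping:
  assumes closed: "\<And>s. s \<in> S \<Longrightarrow> set_pmf (K s) \<subseteq> S"
    and lump: "\<And>s. s \<in> S \<Longrightarrow> K' (h s) = map_pmf h (K s)"
    and "s \<in> S"
  shows "path_measure K' (h s) = distr (path_measure K s) (stream_space (count_space UNIV)) (smap h)"
proof (rule stream_space_eq_sstart[where S=UNIV])
  show "prob_space (distr (path_measure K s) (stream_space (count_space UNIV)) (smap h))"
    by (intro prob_space.prob_space_distr prob_space_path_measure measurable_smap_path_measure)
  show "emeasure (path_measure K' (h s)) (sstart UNIV xs) =
      emeasure (distr (path_measure K s) (stream_space (count_space UNIV)) (smap h)) (sstart UNIV xs)" for xs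
  proof -
    have "emeasure (path_measure K' (h s)) (sstart UNIV xs) =
        emeasure (path_measure K s) (smap h -` sstart UNIV xs)"
      using closed lump \<open>s \<in> S\<close> by (rule emeasure_path_measure_lumping_sstart)
    then show ?thesis by (simp add: emeasure_distr[OF measurable_smap_path_measure])
  qed
qed (auto simp: prob_space_path_measure)

lemma measure_path_measure_lumping:
  assumes closed: "\<And>s. s \<in> S \<Longrightarrow> set_pmf (K s) \<subseteq> S"
    and lump: "\<And>s. s \<in> S \<Longrightarrow> K' (h s) = map_pmf h (K s)"
    and "s \<in> S"
    and A: "A \<in> sets (path_measure K s)" and A': "A' \<in> sets (path_measure K' (h s))"
    and events: "\<And>\<omega>. (\<And>n. \<omega> !! n \<in> S) \<Longrightarrow> smap h \<omega> \<in> A' \<longleftrightarrow> \<omega> \<in> A"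
  shows "measure (path_measure K' (h s)) A' = measure (path_measure K s) A"
proof -
  have "path_measure K' (h s) = distr (path_measure K s) (stream_space (count_space UNIV)) (smap h)"
    using closed lump \<open>s \<in> S\<close> by (rule path_measure_lumping)
  then have "measure (path_measure K' (h s)) A' = measure (path_measure K s) (smap h -` A')"
    using A' by (simp add: measure_distr[OF measurable_smap_path_measure])
  also have "\<dots> = measure (path_measure K s) A"
  proof (rule measure_eq_AE)
    have "AE \<omega> in path_measure K s. \<forall>n. \<omega> !! n \<in> S"
      using closed \<open>s \<in> S\<close> by (rule AE_path_measure_closed)
    then show "AE \<omega> in path_measure K s. \<omega> \<in> smap h -` A' \<longleftrightarrow> \<omega> \<in> A"
      by eventually_elim (simp add: events)
    show "smap h -` A' \<in> sets (path_measure K s)"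
      using measurable_sets[OF measurable_smap_path_measure] A' by simp
  qed (rule A)
  finally show ?thesis .
qed

locale mc_lumping =
  fixes D D' :: "'ap mc" and h :: "nat \<Rightarrow> nat"
  assumes mc: "is_mc D"
    and trans_dist: "s \<in> states D \<Longrightarrow> trans_dist D' (h s) = map_pmf h (trans_dist D s)"
    and state_label: "s \<in> states D \<Longrightarrow> state_label D' (h s) = state_label D s"

lemma (in mc_lumping)
  shows sat_iff: "s \<in> states D \<Longrightarrow> sat \<Phi> D' (h s) \<longleftrightarrow> sat \<Phi> D s"
    and path_sat_iff: "(\<And>n. \<omega> !! n \<in> states D) \<Longrightarrow> path_sat \<phi> D' (smap h \<omega>) \<longleftrightarrow> path_sat \<phi> D \<omega>"
proof (induction \<Phi> and \<phi> arbitrary: s and \<omega>)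
  case (Prob c q \<phi>)
  have "measure (path_measure (trans_dist D') (h s)) {\<omega>. path_sat \<phi> D' \<omega>} =
      measure (path_measure (trans_dist D) s) {\<omega>. path_sat \<phi> D \<omega>}"
  proof (rule measure_path_measure_lumping[where S="states D"])
    show "set_pmf (trans_dist D t) \<subseteq> states D" if "t \<in> states D" for t
      using mc that by (simp add: is_mc_def)
  qed (simp_all only: trans_dist Prob path_sat_measurable mem_Collect_eq)
  then show ?case by simp
next
  case (Next \<Phi>)
  then show ?case using Next.prems[of 1] by simp
qed (simp_all add: state_label)

lemma sat_Top [simp]: "sat Top D s"
  by (simp add: Top_def Disj_def Let_def)

lemma sat_eventually_pos_iff:
  "sat (Prob Greater 0 (Eventually \<Phi>)) D s \<longleftrightarrow> (\<exists>t. (succ_rel (trans_dist D))\<^sup>*\<^sup>* s t \<and> sat \<Phi> D t)"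
proof -
  let ?M = "path_measure (trans_dist D) s"
  interpret prob_space ?M by (rule prob_space_path_measure)
  have "sat (Prob Greater 0 (Eventually \<Phi>)) D s \<longleftrightarrow> emeasure ?M {\<omega>. \<exists>n. \<omega> !! n \<in> {t. sat \<Phi> D t}} \<noteq> 0"
    by (simp add: Eventually_def emeasure_eq_measure zero_less_measure_iff)
  then show ?thesis
    unfolding emeasure_path_measure_visit_eq_0_iff by auto
qed


section \<open>Total probabilistic trees\<close>

definition node_pmf :: "'ap pt \<Rightarrow> nat list \<Rightarrow> nat list pmf" where
  "node_pmf T \<pi> = the (node_dist T \<pi>)"

lemma edge_prob_eq_pmf: "\<pi> \<in> dom (node_dist T) \<Longrightarrow> edge_prob T \<pi> \<pi>' = pmf (node_pmf T \<pi>) \<pi>'"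
  by (auto simp: edge_prob_def node_pmf_def)

lemma Nil_notin_nodes: "T \<in> total_pts \<Longrightarrow> [] \<notin> nodes T"
  unfolding total_pts_def is_pt_def by blast

lemma total_pts_prefix:
  assumes "T \<in> total_pts" "\<pi>' \<in> nodes T" "prefix \<pi> \<pi>'" "\<pi> \<noteq> []"
  shows "\<pi> \<in> nodes T"
proof -
  have "\<forall>\<pi> \<pi>'. \<pi>' \<in> nodes T \<union> {[]} \<and> prefix \<pi> \<pi>' \<longrightarrow> \<pi> \<in> nodes T \<union> {[]}"
    using assms(1) unfolding total_pts_def is_pt_def by (elim CollectE conjE)
  with assms(2-) show ?thesis by fastforce
qed

lemma dom_node_label: "T \<in> total_pts \<Longrightarrow> dom (node_label T) = nodes T"
  unfolding total_pts_def is_pt_def by (elim CollectE conjE)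

lemma total_pts_edge_prob_pos_iff:
  "T \<in> total_pts \<Longrightarrow> \<pi> \<in> nodes T \<Longrightarrow> edge_prob T \<pi> \<pi>' > 0 \<longleftrightarrow> (\<exists>n. \<pi>' = \<pi> @ [n] \<and> \<pi>' \<in> nodes T)"
  by (simp add: total_pts_def is_pt_def)

lemma dom_node_dist:
  assumes T: "T \<in> total_pts"
  shows "dom (node_dist T) = nodes T"
proof
  show "dom (node_dist T) \<subseteq> nodes T"
    using T unfolding total_pts_def is_pt_def by (elim CollectE conjE)
  show "nodes T \<subseteq> dom (node_dist T)"
  proof
    fix \<pi> assume \<pi>: "\<pi> \<in> nodes T"
    obtain \<pi>' where "\<pi>' \<in> nodes T" "strict_prefix \<pi> \<pi>'"
      using T \<pi> by (auto simp: total_pts_def)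
    then obtain n where "\<pi> @ [n] \<in> nodes T"
      using total_pts_prefix[OF T, of \<pi>' "\<pi> @ [_]"] by (auto elim!: strict_prefixE')
    then have "edge_prob T \<pi> (\<pi> @ [n]) > 0"
      by (simp add: total_pts_edge_prob_pos_iff[OF T \<pi>])
    then show "\<pi> \<in> dom (node_dist T)"
      by (auto simp: edge_prob_def split: option.splits)
  qed
qed

lemma set_node_pmf:
  assumes "T \<in> total_pts" "\<pi> \<in> nodes T"
  shows "set_pmf (node_pmf T \<pi>) = {\<pi> @ [n] | n. \<pi> @ [n] \<in> nodes T}"
proof -
  have "\<pi>' \<in> set_pmf (node_pmf T \<pi>) \<longleftrightarrow> edge_prob T \<pi> \<pi>' > 0" for \<pi>'
    using assms by (simp add: edge_prob_eq_pmf dom_node_dist pmf_positive_iff)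
  then show ?thesis using total_pts_edge_prob_pos_iff[OF assms] by auto
qed

lemma set_node_pmf_subset:
  "T \<in> total_pts \<Longrightarrow> \<pi> \<in> nodes T \<Longrightarrow> set_pmf (node_pmf T \<pi>) \<subseteq> nodes T"
  by (auto simp: set_node_pmf)

lemma total_ptsI:
  assumes Nil: "[] \<notin> nodes T"
    and parent: "\<And>\<pi> n. \<pi> @ [n] \<in> nodes T \<Longrightarrow> \<pi> \<noteq> [] \<Longrightarrow> \<pi> \<in> nodes T"
    and root: "\<And>m n. [m] \<in> nodes T \<Longrightarrow> [n] \<in> nodes T \<Longrightarrow> m = n"
    and label: "dom (node_label T) = nodes T"
    and dist: "dom (node_dist T) = nodes T"
    and children: "\<And>\<pi>. \<pi> \<in> nodes T \<Longrightarrow> set_pmf (node_pmf T \<pi>) = {\<pi> @ [n] | n. \<pi> @ [n] \<in> nodes T}"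
  shows "T \<in> total_pts"
proof -
  have "is_pt T"
    unfolding is_pt_def
  proof (intro conjI allI impI ballI)
    show "\<pi> \<in> nodes T \<union> {[]}" if "\<pi>' \<in> nodes T \<union> {[]} \<and> prefix \<pi> \<pi>'" for \<pi> \<pi>'
      using that by (induction \<pi>' rule: rev_induct) (use parent in auto)
    show "edge_prob T \<pi> \<pi>' > 0 \<longleftrightarrow> (\<exists>n. \<pi>' = \<pi> @ [n] \<and> \<pi>' \<in> nodes T)" if "\<pi> \<in> nodes T" for \<pi> \<pi>'
      using children[OF that] by (auto simp: edge_prob_eq_pmf dist that pmf_positive_iff)
  qed (use Nil root label dist in auto)
  moreover have "\<exists>\<pi>'\<in>nodes T. strict_prefix \<pi> \<pi>'" if \<pi>: "\<pi> \<in> nodes T" for \<pi>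
  proof -
    obtain n where "\<pi> @ [n] \<in> nodes T"
      using children[OF \<pi>] set_pmf_not_empty[of "node_pmf T \<pi>"] by auto
    then show ?thesis by (intro bexI[of _ "\<pi> @ [n]"]) (auto simp: strict_prefix_def)
  qed
  ultimately show ?thesis by (simp add: total_pts_def)
qed

text \<open>Unspecified if \<open>T\<close> is the empty tree, which is total.\<close>

definition root_of :: "'ap pt \<Rightarrow> nat list" where
  "root_of T = [THE n. [n] \<in> nodes T]"

lemma root_of_eq:
  assumes T: "T \<in> total_pts" and \<pi>: "\<pi> \<in> nodes T"
  shows "root_of T = [hd \<pi>]"
proof -
  have "[hd \<pi>] \<in> nodes T"
    using Nil_notin_nodes[OF T] \<pi> by (intro total_pts_prefix[OF T \<pi>]) (cases \<pi>, auto)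
  then show ?thesis
    using T unfolding root_of_def total_pts_def is_pt_def by (auto intro!: the_equality)
qed

lemma root_of_prefix: "T \<in> total_pts \<Longrightarrow> \<pi> \<in> nodes T \<Longrightarrow> prefix (root_of T) \<pi>"
  using Nil_notin_nodes by (cases \<pi>) (auto simp: root_of_eq)

lemma root_of_in_nodes: "T \<in> total_pts \<Longrightarrow> nodes T \<noteq> {} \<Longrightarrow> root_of T \<in> nodes T"
  using total_pts_prefix[OF _ _ root_of_prefix] by (auto simp: root_of_def)

lemma total_pts_induct [consumes 2, case_names root child]:
  assumes T: "T \<in> total_pts" and \<pi>: "\<pi> \<in> nodes T"
    and root: "P (root_of T)"
    and child: "\<And>\<pi> n. \<pi> \<in> nodes T \<Longrightarrow> \<pi> @ [n] \<in> nodes T \<Longrightarrow> P \<pi> \<Longrightarrow> P (\<pi> @ [n])"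
  shows "P \<pi>"
  using \<pi>
proof (induction \<pi> rule: rev_induct)
  case Nil
  then show ?case using Nil_notin_nodes[OF T] by simp
next
  case (snoc n \<pi>)
  show ?case
  proof (cases "\<pi> = []")
    case True
    then show ?thesis using root root_of_eq[OF T snoc.prems] by simp
  next
    case False
    then have "\<pi> \<in> nodes T" using total_pts_prefix[OF T snoc.prems] by simp
    then show ?thesis using child snoc by blast
  qed
qed


section \<open>Homomorphisms of total trees\<close>

lemma eq_map_pmf_iff:
  assumes inj: "inj_on f A" and sub: "set_pmf p \<subseteq> A"
  shows "q = map_pmf f p \<longleftrightarrow> (\<forall>x\<in>A. pmf q (f x) = pmf p x)"
proof -
  have pmf_map: "pmf (map_pmf f p) (f x) = pmf p x" if "x \<in> A" for x
  proof (cases "x \<in> set_pmf p")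
    case True
    with inj_on_subset[OF inj sub] show ?thesis by (rule pmf_map_inj)
  next
    case False
    then have "f x \<notin> f ` set_pmf p" using inj sub that by (auto dest: inj_onD)
    with False show ?thesis by (simp add: pmf_map_outside set_pmf_iff)
  qed
  have "q = map_pmf f p" if eq: "\<forall>x\<in>A. pmf q (f x) = pmf p x"
  proof (rule ccontr)
    assume "q \<noteq> map_pmf f p"
    then obtain y where less: "pmf q y < pmf (map_pmf f p) y" using pmf_neq_exists_less by blast
    then have "pmf (map_pmf f p) y > 0" by (rule le_less_trans[OF pmf_nonneg])
    then have "y \<in> set_pmf (map_pmf f p)" by (simp only: pmf_positive_iff)
    then obtain x where "x \<in> A" "y = f x" using sub by auto
    with less eq show False by (simp add: pmf_map)
  qed
  then show ?thesis using pmf_map by blast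
qed

locale pt_hom =
  fixes T1 T2 :: "'ap pt" and f :: "nat list \<Rightarrow> nat list"
  assumes source: "T1 \<in> total_pts" and target: "T2 \<in> total_pts"
    and in_nodes: "\<pi> \<in> nodes T1 \<Longrightarrow> f \<pi> \<in> nodes T2"
    and node_label: "\<pi> \<in> nodes T1 \<Longrightarrow> node_label T2 (f \<pi>) = node_label T1 \<pi>"
    and node_pmf: "\<pi> \<in> nodes T1 \<Longrightarrow> node_pmf T2 (f \<pi>) = map_pmf f (node_pmf T1 \<pi>)"
begin

lemma image_child:
  assumes "\<pi> \<in> nodes T1" "\<pi> @ [n] \<in> nodes T1"
  shows "\<exists>m. f (\<pi> @ [n]) = f \<pi> @ [m]"
proof -
  have "f (\<pi> @ [n]) \<in> f ` set_pmf (node_pmf T1 \<pi>)"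
    using assms by (auto simp: set_node_pmf[OF source])
  also have "\<dots> = set_pmf (node_pmf T2 (f \<pi>))"
    using assms(1) by (simp add: node_pmf)
  finally show ?thesis
    using assms(1) by (auto simp: set_node_pmf[OF target] in_nodes)
qed

lemma prefix_mono:
  assumes "\<pi>' \<in> nodes T1" "\<pi> \<in> nodes T1" "prefix \<pi> \<pi>'"
  shows "prefix (f \<pi>) (f \<pi>')"
  using source assms
proof (induction \<pi>' rule: total_pts_induct)
  case root
  then have "\<pi> = root_of T1" using root_of_prefix[OF source] prefix_order.antisym by blast
  then show ?case by simp
next
  case (child \<pi>' n)
  obtain m where "f (\<pi>' @ [n]) = f \<pi>' @ [m]"
    using image_child child.hyps by blast
  with child show ?case by auto
qed

context
  assumes image_root: "f (root_of T1) = root_of T2"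
begin

lemma length_eq:
  assumes "\<pi> \<in> nodes T1"
  shows "length (f \<pi>) = length \<pi>"
  using source assms
proof (induction \<pi> rule: total_pts_induct)
  case root
  then show ?case unfolding image_root by (simp add: root_of_def)
next
  case (child \<pi> n)
  then show ?case using image_child[of \<pi> n] by auto
qed

lemma image_nodes_eq:
  assumes "nodes T1 \<noteq> {}"
  shows "f ` nodes T1 = nodes T2"
proof
  show "f ` nodes T1 \<subseteq> nodes T2" using in_nodes by blast
  have "\<pi> \<in> f ` nodes T1" if "\<pi> \<in> nodes T2" for \<pi>
    using target that
  proof (induction \<pi> rule: total_pts_induct)
    case root
    show ?case
      using root_of_in_nodes[OF source assms] image_root by force
  next
    case (child \<pi> n)
    then obtain \<pi>' where \<pi>': "\<pi>' \<in> nodes T1" "\<pi> = f \<pi>'" by blast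
    have "\<pi> @ [n] \<in> set_pmf (node_pmf T2 (f \<pi>'))"
      using child.hyps \<pi>' by (simp add: set_node_pmf[OF target])
    also have "\<dots> \<subseteq> f ` nodes T1"
      using set_node_pmf_subset[OF source \<pi>'(1)] by (auto simp: node_pmf[OF \<pi>'(1)])
    finally show ?case .
  qed
  then show "nodes T2 \<subseteq> f ` nodes T1" by blast
qed

lemma prefix_iff:
  assumes inj: "inj_on f (nodes T1)" and \<pi>: "\<pi> \<in> nodes T1" and \<pi>': "\<pi>' \<in> nodes T1"
  shows "prefix (f \<pi>) (f \<pi>') \<longleftrightarrow> prefix \<pi> \<pi>'"
proof
  assume prefix: "prefix (f \<pi>) (f \<pi>')"
  define \<rho> where "\<rho> = take (length \<pi>) \<pi>'"
  have "length \<pi> \<le> length \<pi>'"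
    using prefix_length_le[OF prefix] by (simp add: length_eq \<pi> \<pi>')
  then have len: "length \<rho> = length \<pi>" by (simp add: \<rho>_def)
  have "prefix \<rho> \<pi>'" by (simp add: \<rho>_def take_is_prefix)
  moreover have "\<rho> \<noteq> []" using Nil_notin_nodes[OF source] \<pi> len by auto
  ultimately have \<rho>: "\<rho> \<in> nodes T1" by (rule total_pts_prefix[OF source \<pi>'])
  have "prefix (f \<rho>) (f \<pi>')"
    using \<open>prefix \<rho> \<pi>'\<close> by (rule prefix_mono[OF \<pi>' \<rho>])
  then have "f \<rho> = f \<pi>"
    using prefix len length_eq[OF \<pi>] length_eq[OF \<rho>]
    by (metis prefix_length_prefix prefix_order.antisym order_refl)
  then have "\<rho> = \<pi>" using inj \<rho> \<pi> by (simp add: inj_onD)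
  with \<open>prefix \<rho> \<pi>'\<close> show "prefix \<pi> \<pi>'" by simp
qed (rule prefix_mono[OF \<pi>' \<pi>])

end

end

lemma pt_hom_iff_edge_prob:
  assumes T: "T1 \<in> total_pts" "T2 \<in> total_pts" and inj: "inj_on f (nodes T1)"
  shows "pt_hom T1 T2 f \<longleftrightarrow> (\<forall>\<pi>\<in>nodes T1. f \<pi> \<in> nodes T2 \<and> node_label T2 (f \<pi>) = node_label T1 \<pi> \<and>
    (\<forall>\<pi>'\<in>nodes T1. edge_prob T2 (f \<pi>) (f \<pi>') = edge_prob T1 \<pi> \<pi>'))"
proof -
  have "node_pmf T2 (f \<pi>) = map_pmf f (node_pmf T1 \<pi>) \<longleftrightarrow>
      (\<forall>\<pi>'\<in>nodes T1. edge_prob T2 (f \<pi>) (f \<pi>') = edge_prob T1 \<pi> \<pi>')"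
    if "\<pi> \<in> nodes T1" "f \<pi> \<in> nodes T2" for \<pi>
    using that eq_map_pmf_iff[OF inj set_node_pmf_subset] T
    by (simp add: edge_prob_eq_pmf dom_node_dist)
  then show ?thesis using T unfolding pt_hom_def by blast
qed

lemma pt_iso_iff_pt_hom:
  assumes T1: "T1 \<in> total_pts" "nodes T1 \<noteq> {}" and T2: "T2 \<in> total_pts"
  shows "pt_iso T1 T2 \<longleftrightarrow> (\<exists>f. pt_hom T1 T2 f \<and> inj_on f (nodes T1) \<and> f (root_of T1) = root_of T2)"
proof
  assume "pt_iso T1 T2"
  then obtain f where bij: "bij_betw f (nodes T1) (nodes T2)"
    and prefix: "\<forall>\<pi>\<in>nodes T1. \<forall>\<pi>'\<in>nodes T1. prefix \<pi> \<pi>' \<longleftrightarrow> prefix (f \<pi>) (f \<pi>')"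
    and label: "\<forall>\<pi>\<in>nodes T1. node_label T2 (f \<pi>) = node_label T1 \<pi>"
    and edge: "\<forall>\<pi>\<in>nodes T1. \<forall>\<pi>'\<in>nodes T1. edge_prob T2 (f \<pi>) (f \<pi>') = edge_prob T1 \<pi> \<pi>'"
    unfolding pt_iso_def by blast
  have inj: "inj_on f (nodes T1)" using bij by (rule bij_betw_imp_inj_on)
  have hom: "pt_hom T1 T2 f"
    unfolding pt_hom_iff_edge_prob[OF T1(1) T2 inj] using bij label edge by (auto dest: bij_betwE)
  have root1: "root_of T1 \<in> nodes T1" using T1 by (rule root_of_in_nodes)
  then have "root_of T2 \<in> f ` nodes T1"
    using root_of_in_nodes[OF T2] bij by (auto simp: bij_betw_def)
  then obtain \<pi> where \<pi>: "\<pi> \<in> nodes T1" "root_of T2 = f \<pi>" by blast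
  have "prefix (f (root_of T1)) (root_of T2)"
    using prefix root1 \<pi> root_of_prefix[OF T1(1) \<pi>(1)] by simp
  moreover have "prefix (root_of T2) (f (root_of T1))"
    using root_of_prefix[OF T2] bij root1 by (auto dest: bij_betwE)
  ultimately have "f (root_of T1) = root_of T2" by (rule prefix_order.antisym)
  with hom inj show "\<exists>f. pt_hom T1 T2 f \<and> inj_on f (nodes T1) \<and> f (root_of T1) = root_of T2"
    by blast
next
  assume "\<exists>f. pt_hom T1 T2 f \<and> inj_on f (nodes T1) \<and> f (root_of T1) = root_of T2"
  then obtain f where hom: "pt_hom T1 T2 f" and inj: "inj_on f (nodes T1)"
    and root: "f (root_of T1) = root_of T2" by blast
  have "bij_betw f (nodes T1) (nodes T2)"
    using inj pt_hom.image_nodes_eq[OF hom root T1(2)] by (simp add: bij_betw_def)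
  then show "pt_iso T1 T2"
    using pt_hom.prefix_iff[OF hom root inj] hom[unfolded pt_hom_iff_edge_prob[OF T1(1) T2 inj]]
    unfolding pt_iso_def by blast
qed

lemma suffix_pt_iff_pt_hom:
  assumes "T' \<in> total_pts" "T \<in> total_pts"
  shows "suffix_pt T' T \<longleftrightarrow> (\<exists>u\<in>nodes T. pt_hom T' T ((@) u))"
  unfolding suffix_pt_def
  by (rule bex_cong) (auto simp: pt_hom_iff_edge_prob assms inj_on_def)


section \<open>Total trees as Markov chains\<close>

definition tree_chain :: "'ap pt \<Rightarrow> 'ap mc" where
  "tree_chain T = \<lparr>
     states = to_nat ` nodes T,
     trans_dist = (\<lambda>s. map_pmf to_nat (node_pmf T (from_nat s))),
     state_label = (\<lambda>s. the (node_label T (from_nat s))),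
     init = to_nat (root_of T)\<rparr>"

lemma tree_chain_simps [simp]:
  "states (tree_chain T) = to_nat ` nodes T"
  "trans_dist (tree_chain T) (to_nat \<pi>) = map_pmf to_nat (node_pmf T \<pi>)"
  "state_label (tree_chain T) (to_nat \<pi>) = the (node_label T \<pi>)"
  "init (tree_chain T) = to_nat (root_of T)"
  by (simp_all add: tree_chain_def)

lemma is_mc_tree_chain: "T \<in> total_pts \<Longrightarrow> nodes T \<noteq> {} \<Longrightarrow> is_mc (tree_chain T)"
  using root_of_in_nodes[of T] by (auto simp: is_mc_def set_node_pmf)

definition node_sat :: "'ap state_formula \<Rightarrow> 'ap pt \<Rightarrow> nat list \<Rightarrow> bool" where
  "node_sat \<Phi> T \<pi> \<longleftrightarrow> sat \<Phi> (tree_chain T) (to_nat \<pi>)"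

lemma mc_sat_tree_chain: "mc_sat (tree_chain T) \<Phi> \<longleftrightarrow> node_sat \<Phi> T (root_of T)"
  by (simp add: mc_sat_def node_sat_def)

lemma node_sat_lumping:
  assumes T: "T \<in> total_pts"
    and dist: "\<And>\<pi>. \<pi> \<in> nodes T \<Longrightarrow> trans_dist D (h \<pi>) = map_pmf h (node_pmf T \<pi>)"
    and label: "\<And>\<pi>. \<pi> \<in> nodes T \<Longrightarrow> state_label D (h \<pi>) = the (node_label T \<pi>)"
    and \<pi>: "\<pi> \<in> nodes T"
  shows "node_sat \<Phi> T \<pi> \<longleftrightarrow> sat \<Phi> D (h \<pi>)"
proof -
  interpret mc_lumping "tree_chain T" D "h \<circ> from_nat"
    using is_mc_tree_chain[OF T] \<pi> by unfold_locales (auto simp: dist label pmf.map_comp o_def)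
  show ?thesis
    using sat_iff[of "to_nat \<pi>"] \<pi> by (simp add: node_sat_def)
qed

lemma (in pt_hom) node_sat_iff:
  assumes "\<pi> \<in> nodes T1"
  shows "node_sat \<Phi> T2 (f \<pi>) \<longleftrightarrow> node_sat \<Phi> T1 \<pi>"
  unfolding node_sat_def[of \<Phi> T2]
  by (rule node_sat_lumping[OF source _ _ assms, symmetric])
    (simp_all add: node_pmf node_label pmf.map_comp o_def)

lemma nodes_unfolding_pt [simp]: "nodes (unfolding_pt D) = unfolding_nodes D"
  by (simp add: unfolding_pt_def)

lemma node_label_unfolding_pt:
  "\<pi> \<in> unfolding_nodes D \<Longrightarrow> node_label (unfolding_pt D) \<pi> = Some (state_label D (last \<pi>))"
  by (simp add: unfolding_pt_def)

lemma node_pmf_unfolding_pt: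
  "\<pi> \<in> unfolding_nodes D \<Longrightarrow>
    node_pmf (unfolding_pt D) \<pi> = map_pmf (\<lambda>t. \<pi> @ [t]) (trans_dist D (last \<pi>))"
  by (simp add: unfolding_pt_def node_pmf_def)

lemma unfolding_nodes_nonempty [simp]: "unfolding_nodes D \<noteq> {}"
  using unfolding_nodes.root by blast

lemma root_of_unfolding_pt: "root_of (unfolding_pt D) = [init D]"
  using root_of_eq[OF unfolding_total_pt, of "[init D]" D] by (simp add: unfolding_nodes.root)

lemma node_sat_unfolding_pt:
  assumes "\<pi> \<in> unfolding_nodes D"
  shows "node_sat \<Phi> (unfolding_pt D) \<pi> \<longleftrightarrow> sat \<Phi> D (last \<pi>)"
  by (rule node_sat_lumping[OF unfolding_total_pt])
    (use assms in \<open>auto simp: node_label_unfolding_pt node_pmf_unfolding_pt pmf.map_comp o_def\<close>)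

lemma mc_sat_iff_node_sat_if_pt_iso:
  assumes T: "T \<in> total_pts" and iso: "pt_iso (unfolding_pt D) T"
  shows "mc_sat D \<Phi> \<longleftrightarrow> node_sat \<Phi> T (root_of T)"
proof -
  obtain f where hom: "pt_hom (unfolding_pt D) T f" and root: "f [init D] = root_of T"
    using iso
    by (auto simp: pt_iso_iff_pt_hom unfolding_total_pt T root_of_unfolding_pt)
  have "mc_sat D \<Phi> \<longleftrightarrow> node_sat \<Phi> (unfolding_pt D) [init D]"
    by (simp add: mc_sat_def node_sat_unfolding_pt unfolding_nodes.root)
  also have "\<dots> \<longleftrightarrow> node_sat \<Phi> T (f [init D])"
    by (simp add: pt_hom.node_sat_iff[OF hom] unfolding_nodes.root)
  finally show ?thesis by (simp add: root)
qed

lemma unfolding_nodes_tree_chain: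
  assumes T: "T \<in> total_pts" "nodes T \<noteq> {}" and "xs \<in> unfolding_nodes (tree_chain T)"
  shows "\<exists>\<pi>\<in>nodes T. last xs = to_nat \<pi> \<and> xs = map to_nat (tl (prefixes \<pi>))"
  using assms(3)
proof (induction rule: unfolding_nodes.induct)
  case root
  show ?case
    using root_of_in_nodes[OF T] by (intro bexI[of _ "root_of T"]) (simp_all add: root_of_def)
next
  case (step xs t)
  then obtain \<pi> where \<pi>: "\<pi> \<in> nodes T" "last xs = to_nat \<pi>" "xs = map to_nat (tl (prefixes \<pi>))"
    by blast
  then obtain n where "\<pi> @ [n] \<in> nodes T" "t = to_nat (\<pi> @ [n])"
    using step.hyps(2) by (auto simp: pmf_positive_iff set_node_pmf[OF T(1)])
  with \<pi>(3) show ?case by (intro bexI[of _ "\<pi> @ [n]"]) simp_all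
qed

lemma pt_iso_unfolding_tree_chain:
  assumes T: "T \<in> total_pts" "nodes T \<noteq> {}"
  shows "pt_iso (unfolding_pt (tree_chain T)) T"
proof -
  define f :: "nat list \<Rightarrow> nat list" where "f xs = from_nat (last xs)" for xs
  have node: "f xs \<in> nodes T" "last xs = to_nat (f xs)" "xs = map to_nat (tl (prefixes (f xs)))"
    if "xs \<in> unfolding_nodes (tree_chain T)" for xs
    using unfolding_nodes_tree_chain[OF T that] by (auto simp: f_def)
  have "pt_hom (unfolding_pt (tree_chain T)) T f"
  proof
    fix xs assume "xs \<in> nodes (unfolding_pt (tree_chain T))"
    then have xs: "xs \<in> unfolding_nodes (tree_chain T)" by simp
    show "f xs \<in> nodes T" using xs by (rule node)
    then show "node_label T (f xs) = node_label (unfolding_pt (tree_chain T)) xs"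
      unfolding dom_node_label[OF T(1), symmetric]
      by (auto simp: node_label_unfolding_pt[OF xs] node(2)[OF xs])
    have "map_pmf f (node_pmf (unfolding_pt (tree_chain T)) xs) =
        map_pmf from_nat (trans_dist (tree_chain T) (last xs))"
      by (simp add: node_pmf_unfolding_pt[OF xs] pmf.map_comp o_def f_def)
    also have "\<dots> = node_pmf T (f xs)"
      by (simp add: node(2)[OF xs] pmf.map_comp o_def)
    finally show "node_pmf T (f xs) = map_pmf f (node_pmf (unfolding_pt (tree_chain T)) xs)" ..
  qed (simp_all add: unfolding_total_pt T)
  moreover have "inj_on f (unfolding_nodes (tree_chain T))"
    by (rule inj_onI) (metis node(3))
  moreover have "f (root_of (unfolding_pt (tree_chain T))) = root_of T"
    by (simp add: root_of_unfolding_pt f_def)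
  ultimately show ?thesis
    by (auto simp: pt_iso_iff_pt_hom unfolding_total_pt T)
qed


section \<open>Properties of formulas\<close>

lemma property_of_iff:
  "T \<in> property_of \<Phi> \<longleftrightarrow> T \<in> total_pts \<and> nodes T \<noteq> {} \<and> node_sat \<Phi> T (root_of T)"
proof
  assume "T \<in> property_of \<Phi>"
  then obtain D where T: "T \<in> total_pts" and D: "mc_sat D \<Phi>" "pt_iso (unfolding_pt D) T"
    by (auto simp: property_of_def)
  moreover have "nodes T \<noteq> {}"
    using D(2) bij_betw_empty2 by (fastforce simp: pt_iso_def)
  ultimately show "T \<in> total_pts \<and> nodes T \<noteq> {} \<and> node_sat \<Phi> T (root_of T)"
    using mc_sat_iff_node_sat_if_pt_iso by blast
next
  assume "T \<in> total_pts \<and> nodes T \<noteq> {} \<and> node_sat \<Phi> T (root_of T)"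
  then show "T \<in> property_of \<Phi>"
    using is_mc_tree_chain pt_iso_unfolding_tree_chain mc_sat_tree_chain
    unfolding property_of_def by blast
qed

lemma property_of_Bot: "property_of Bot = {}"
  by (auto simp: property_of_iff node_sat_def Bot_def)

lemma tree_chain_reachable_iff:
  assumes T: "T \<in> total_pts" "nodes T \<noteq> {}"
  shows "(succ_rel (trans_dist (tree_chain T)))\<^sup>*\<^sup>* (to_nat (root_of T)) t \<longleftrightarrow> t \<in> to_nat ` nodes T"
    (is "?R\<^sup>*\<^sup>* _ _ \<longleftrightarrow> _")
proof
  assume "?R\<^sup>*\<^sup>* (to_nat (root_of T)) t"
  then show "t \<in> to_nat ` nodes T"
    by (induction rule: rtranclp_induct) (auto simp: root_of_in_nodes set_node_pmf T)
next
  have "?R\<^sup>*\<^sup>* (to_nat (root_of T)) (to_nat \<pi>)" if "\<pi> \<in> nodes T" for \<pi>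
    using T(1) that
  proof (induction \<pi> rule: total_pts_induct)
    case (child \<pi> n)
    then have "?R (to_nat \<pi>) (to_nat (\<pi> @ [n]))" by (auto simp: set_node_pmf T)
    with child.IH show ?case by (rule rtranclp.rtrancl_into_rtrancl)
  qed simp
  then show "?R\<^sup>*\<^sup>* (to_nat (root_of T)) t" if "t \<in> to_nat ` nodes T"
    using that by blast
qed

lemma property_of_eventually_pos_iff:
  "T \<in> property_of (Prob Greater 0 (Eventually \<Phi>)) \<longleftrightarrow> T \<in> total_pts \<and> (\<exists>\<pi>\<in>nodes T. node_sat \<Phi> T \<pi>)"
proof -
  have "node_sat (Prob Greater 0 (Eventually \<Phi>)) T (root_of T) \<longleftrightarrow> (\<exists>\<pi>\<in>nodes T. node_sat \<Phi> T \<pi>)"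
    if "T \<in> total_pts" "nodes T \<noteq> {}"
    unfolding node_sat_def sat_eventually_pos_iff tree_chain_reachable_iff[OF that] by blast
  then show ?thesis unfolding property_of_iff by blast
qed

text \<open>The nodes keep the entry \<open>n\<close>, because the root of a tree has length 1.\<close>

definition subtree :: "'ap pt \<Rightarrow> nat list \<Rightarrow> nat \<Rightarrow> 'ap pt" where
  "subtree T u n = (let N = {w. prefix [n] w \<and> u @ w \<in> nodes T} in \<lparr>
     nodes = N,
     node_label = (\<lambda>w. node_label T (u @ w)) |` N,
     node_dist = (\<lambda>w. Some (map_pmf (drop (length u)) (node_pmf T (u @ w)))) |` N\<rparr>)"

lemma nodes_subtree: "nodes (subtree T u n) = {w. prefix [n] w \<and> u @ w \<in> nodes T}"
  by (simp add: subtree_def Let_def)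

lemma node_label_subtree:
  "w \<in> nodes (subtree T u n) \<Longrightarrow> node_label (subtree T u n) w = node_label T (u @ w)"
  by (simp add: subtree_def Let_def)

lemma node_pmf_subtree:
  "w \<in> nodes (subtree T u n) \<Longrightarrow>
    node_pmf (subtree T u n) w = map_pmf (drop (length u)) (node_pmf T (u @ w))"
  by (simp add: subtree_def Let_def node_pmf_def)

lemma subtree_total_pt:
  assumes T: "T \<in> total_pts"
  shows "subtree T u n \<in> total_pts"
proof (rule total_ptsI)
  show "w \<in> nodes (subtree T u n)" if "w @ [m] \<in> nodes (subtree T u n)" "w \<noteq> []" for w m
    using that total_pts_prefix[OF T, of "u @ w @ [m]" "u @ w"]
    by (cases w) (auto simp: nodes_subtree)
  show "dom (node_label (subtree T u n)) = nodes (subtree T u n)"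
    using dom_node_label[OF T] by (auto simp: subtree_def Let_def)
  show "dom (node_dist (subtree T u n)) = nodes (subtree T u n)"
    by (auto simp: subtree_def Let_def)
  show "set_pmf (node_pmf (subtree T u n) w) = {w @ [m] | m. w @ [m] \<in> nodes (subtree T u n)}"
    if w: "w \<in> nodes (subtree T u n)" for w
  proof -
    have "prefix [n] w" "u @ w \<in> nodes T" using w by (simp_all add: nodes_subtree)
    then show ?thesis
      by (force simp: node_pmf_subtree[OF w] set_node_pmf[OF T] nodes_subtree)
  qed
qed (simp_all add: nodes_subtree)

lemma pt_hom_subtree:
  assumes T: "T \<in> total_pts"
  shows "pt_hom (subtree T u n) T ((@) u)"
proof
  fix w assume w: "w \<in> nodes (subtree T u n)"
  then show uw: "u @ w \<in> nodes T" by (simp add: nodes_subtree)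
  show "node_label T (u @ w) = node_label (subtree T u n) w"
    by (simp add: node_label_subtree[OF w])
  have "map_pmf ((@) u) (node_pmf (subtree T u n) w) = map_pmf id (node_pmf T (u @ w))"
    unfolding node_pmf_subtree[OF w] pmf.map_comp
    by (rule map_pmf_cong) (auto simp: set_node_pmf[OF T uw])
  then show "node_pmf T (u @ w) = map_pmf ((@) u) (node_pmf (subtree T u n) w)" by simp
qed (simp_all add: subtree_total_pt T)

lemma suffix_in_property_of_if_node_sat:
  assumes T: "T \<in> total_pts" and un: "u @ [n] \<in> nodes T" "u \<noteq> []" and sat: "node_sat \<Phi> T (u @ [n])"
  shows "\<exists>T'\<in>property_of \<Phi>. suffix_pt T' T"
proof
  let ?S = "subtree T u n"
  have S: "?S \<in> total_pts" and hom: "pt_hom ?S T ((@) u)"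
    using T by (rule subtree_total_pt, rule pt_hom_subtree)
  have "[n] \<in> nodes ?S" using un by (simp add: nodes_subtree)
  then show "?S \<in> property_of \<Phi>"
    using sat pt_hom.node_sat_iff[OF hom] by (auto simp: property_of_iff S root_of_eq)
  have "u \<in> nodes T" using total_pts_prefix[OF T un(1)] un(2) by simp
  with hom show "suffix_pt ?S T" by (auto simp: suffix_pt_iff_pt_hom S T)
qed

lemma node_sat_if_suffix_in_property_of:
  assumes T: "T \<in> total_pts" and "T' \<in> property_of \<Phi>" and suffix: "suffix_pt T' T"
  shows "\<exists>\<pi>\<in>nodes T. node_sat \<Phi> T \<pi>"
proof -
  have T': "T' \<in> total_pts" "nodes T' \<noteq> {}" "node_sat \<Phi> T' (root_of T')"
    using \<open>T' \<in> property_of \<Phi>\<close> by (simp_all add: property_of_iff)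
  obtain u where hom: "pt_hom T' T ((@) u)"
    using suffix suffix_pt_iff_pt_hom[OF T'(1) T] by blast
  have "root_of T' \<in> nodes T'" using T'(1,2) by (rule root_of_in_nodes)
  then show ?thesis
    using pt_hom.in_nodes[OF hom] pt_hom.node_sat_iff[OF hom] T'(3) by blast
qed

lemma exists_node_sat_iff:
  assumes T: "T \<in> total_pts"
  shows "(\<exists>\<pi>\<in>nodes T. node_sat \<Phi> T \<pi>) \<longleftrightarrow> T \<in> property_of \<Phi> \<or> (\<exists>T'\<in>property_of \<Phi>. suffix_pt T' T)"
proof
  assume "\<exists>\<pi>\<in>nodes T. node_sat \<Phi> T \<pi>"
  then obtain \<pi> where \<pi>: "\<pi> \<in> nodes T" "node_sat \<Phi> T \<pi>" by blast
  then obtain u n where un: "\<pi> = u @ [n]"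
    using Nil_notin_nodes[OF T] by (cases \<pi> rule: rev_cases) auto
  show "T \<in> property_of \<Phi> \<or> (\<exists>T'\<in>property_of \<Phi>. suffix_pt T' T)"
  proof (cases "u = []")
    case True
    then have "T \<in> property_of \<Phi>" using \<pi> un T root_of_eq[OF T \<pi>(1)] by (auto simp: property_of_iff)
    then show ?thesis ..
  next
    case False
    then show ?thesis using suffix_in_property_of_if_node_sat[OF T] \<pi> un by blast
  qed
next
  assume "T \<in> property_of \<Phi> \<or> (\<exists>T'\<in>property_of \<Phi>. suffix_pt T' T)"
  then show "\<exists>\<pi>\<in>nodes T. node_sat \<Phi> T \<pi>"
  proof
    assume "T \<in> property_of \<Phi>"
    then show ?thesis using root_of_in_nodes by (auto simp: property_of_iff)
  next
    assume "\<exists>T'\<in>property_of \<Phi>. suffix_pt T' T"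
    then show ?thesis using node_sat_if_suffix_in_property_of[OF T] by blast
  qed
qed

theorem theorem11:
  fixes \<Phi> :: "('ap::finite) state_formula"
  assumes "wf_state \<Phi>"
  shows "pctl_absolute_liveness \<Phi> \<longleftrightarrow>
    \<not> pctl_equiv \<Phi> Bot \<and> pctl_equiv \<Phi> (Prob Greater 0 (Eventually \<Phi>))"
proof -
  let ?P = "property_of \<Phi>" and ?E = "property_of (Prob Greater 0 (Eventually \<Phi>))"
  have total: "?P \<subseteq> total_pts" by (auto simp: property_of_iff)
  have "?E = {T \<in> total_pts. T \<in> ?P \<or> (\<exists>T'\<in>?P. suffix_pt T' T)}"
    using property_of_eventually_pos_iff exists_node_sat_iff by blast
  then have "?P = ?E \<longleftrightarrow> (\<forall>T\<in>total_pts. \<forall>T'\<in>?P. suffix_pt T' T \<longrightarrow> T \<in> ?P)"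
    using total by blast
  then show ?thesis
    using total
    unfolding pctl_absolute_liveness_def absolute_liveness_def pctl_equiv_def property_of_Bot by blast
qed

end
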